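(* For fixed $\mu>-1$, the sharp constant $$M^*_{\mu,q,\gamma}=\sup_{x>0}\frac{\int_0^x e^{-\gamma t}t^{q-\mu}I_\mu(t)\,dt}{e^{-\gamma x}x^{q-\mu}I_{\mu+1}(x)}$$ is nonincreasing in $q>-1$ (for fixed $\gamma\in(0,1)$) and nondecreasing in $\gamma\in(0,1)$ (for fixed $q>-1$).
   Context: $I_\alpha(x)=\sum_{k=0}^{\infty}\frac{(x/2)^{2k+\alpha}}{k!\,\Gamma(k+\alpha+1)}$, $x>0$, is the modified Bessel function of the first kind. *)

theory Defs
  imports "HOL-Analysis.Analysis"
begin

definition bessel_I :: "real \<Rightarrow> real \<Rightarrow> real" where
  "bessel_I \<alpha> x =
     (\<Sum>k. (x / 2) powr (2 * real k + \<alpha>) / (fact k * Gamma (real k + \<alpha> + 1)))"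

definition bessel_ratio :: "real \<Rightarrow> real \<Rightarrow> real \<Rightarrow> real \<Rightarrow> real" where
  "bessel_ratio \<mu> q \<gamma> x =
     integral {0..x} (\<lambda>t. exp (- \<gamma> * t) * t powr (q - \<mu>) * bessel_I \<mu> t)
       / (exp (- \<gamma> * x) * x powr (q - \<mu>) * bessel_I (\<mu> + 1) x)"

text \<open>The supremum is taken in \<^typ>\<open>ereal\<close>, because on \<^typ>\<open>real\<close> the
  supremum of an unbounded set is an unspecified value.\<close>

definition sharp_const :: "real \<Rightarrow> real \<Rightarrow> real \<Rightarrow> ereal" where
  "sharp_const \<mu> q \<gamma> = (SUP x\<in>{0<..}. ereal (bessel_ratio \<mu> q \<gamma> x))"

end

theory Submission imports Defs
begin

text \<open>
  The monotonicity already holds pointwise in \<open>x\<close>, before any supremum is taken. Moving the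
  factor \<open>exp (- \<gamma> * x) * x powr (q - \<mu>)\<close> of the denominator under the integral sign turns the
  quotient into the integral over \<open>0 \<le> t \<le> x\<close> of
  \<open>exp (\<gamma> * (x - t)) * (t / x) powr (q - \<mu>) * bessel_I \<mu> t\<close>, divided by \<open>bessel_I (\<mu> + 1) x\<close>.
  For \<open>0 \<le> t \<le> x\<close> the base \<open>t/x\<close> is at most one and \<open>x - t\<close> is nonnegative, so the kernel is
  nonincreasing in \<open>q\<close> and nondecreasing in \<open>\<gamma>\<close>, and \<open>I\<^sub>\<mu>\<close> and \<open>I\<^sub>\<mu>\<^sub>+\<^sub>1\<close> are nonnegative
  (lemma \<open>bessel_ratio_mono\<close>).

  Comparing the integrals of two kernels requires both integrals to exist. This is where
  \<open>q > -1\<close> enters: \<open>I\<^sub>\<mu>(t)\<close> is \<open>t\<^sup>\<mu>\<close> times a function continuous up to the origin, so the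
  integrand is \<open>t\<^sup>q\<close> times a continuous function (lemma \<open>bessel_integrand_integrable\<close>).
\<close>

text \<open>The modified Bessel function is \<open>(x/2)\<^sup>\<alpha>\<close> times this series evaluated at \<open>(x/2)\<^sup>2\<close>; it is
  the hypergeometric function \<open>\<^sub>0F\<^sub>1\<close> of parameter \<open>\<alpha> + 1\<close>, divided by \<open>\<Gamma>(\<alpha> + 1)\<close>.\<close>

definition bessel_series :: "real \<Rightarrow> real \<Rightarrow> real" where
  "bessel_series \<alpha> y = (\<Sum>k. 1 / (fact k * Gamma (real k + \<alpha> + 1)) * y ^ k)"

text \<open>Consecutive terms have ratio \<open>y / ((k + 1) (k + \<alpha> + 1))\<close>, which tends to zero.\<close>

lemma summable_bessel_series:
  fixes \<alpha> y :: real
  assumes "\<alpha> > -1"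
  shows "summable (\<lambda>k. 1 / (fact k * Gamma (real k + \<alpha> + 1)) * y ^ k)"
proof (rule summable_ratio_test)
  \<comment> \<open>From this index on \<open>k + 1 > 2 \<bar>y\<bar>\<close> and \<open>k + \<alpha> + 1 > 1\<close>, so the ratio is below one half.\<close>
  fix k :: nat
  assume k: "k \<ge> nat \<lceil>2 * \<bar>y\<bar>\<rceil> + 1"
  define z where "z = real k + \<alpha> + 1"
  have k2: "real k \<ge> 2 * \<bar>y\<bar>" "real k \<ge> 1" using k by linarith+
  have z: "z > 1" using k2 assms by (simp add: z_def)
  have "z \<notin> \<int>\<^sub>\<le>\<^sub>0" using z by (auto elim!: nonpos_Ints_cases)
  hence G: "Gamma (real (Suc k) + \<alpha> + 1) = z * Gamma z"
    using Gamma_plus1[of z] by (simp add: z_def algebra_simps)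
  define P where "P = \<bar>y\<bar> ^ k / (fact k * Gamma z)"
  have P: "P \<ge> 0" using z by (auto simp: P_def intro!: divide_nonneg_pos)
  have Gz: "Gamma z > 0" using z by simp
  have "2 * \<bar>y\<bar> \<le> (real k + 1) * 1" using k2 by simp
  also have "\<dots> \<le> (real k + 1) * z" using z by (intro mult_left_mono) auto
  finally have le: "\<bar>y\<bar> / ((real k + 1) * z) \<le> 1 / 2"
    using z by (simp add: divide_le_eq)
  have "norm (1 / (fact (Suc k) * Gamma (real (Suc k) + \<alpha> + 1)) * y ^ Suc k)
      = \<bar>y\<bar> / ((real k + 1) * z) * P"
    unfolding G using z Gz by (simp add: P_def abs_mult power_abs field_simps)
  also have "\<dots> \<le> 1 / 2 * P" using le P by (rule mult_right_mono)
  also have "\<dots> = 1 / 2 * norm (1 / (fact k * Gamma (real k + \<alpha> + 1)) * y ^ k)"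
    using Gz by (simp add: P_def z_def[symmetric] abs_mult power_abs)
  finally show "norm (1 / (fact (Suc k) * Gamma (real (Suc k) + \<alpha> + 1)) * y ^ Suc k)
      \<le> 1 / 2 * norm (1 / (fact k * Gamma (real k + \<alpha> + 1)) * y ^ k)" .
qed simp

lemma continuous_bessel_series:
  fixes \<alpha> :: real
  assumes "\<alpha> > -1"
  shows "continuous_on A (bessel_series \<alpha>)"
  unfolding bessel_series_def[abs_def]
  by (intro continuous_at_imp_continuous_on ballI isCont_powser_converges_everywhere
      summable_bessel_series assms)

lemma bessel_series_nonneg:
  fixes \<alpha> y :: real
  assumes "\<alpha> > -1" "y \<ge> 0"
  shows "bessel_series \<alpha> y \<ge> 0"
  unfolding bessel_series_def
proof (rule suminf_nonneg[OF summable_bessel_series])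
  fix k :: nat
  have "Gamma (real k + \<alpha> + 1) > 0" using assms by simp
  thus "0 \<le> 1 / (fact k * Gamma (real k + \<alpha> + 1)) * y ^ k" using assms by simp
qed (use assms in simp)

text \<open>At \<open>x = 0\<close> both sides vanish because \<open>0 powr a = 0\<close> for every \<open>a\<close>, so the factorisation
  holds on the closed half-line and integrals over \<open>{0..x}\<close> need no exceptional point.\<close>

lemma bessel_I_eq_powr_mult_series:
  fixes \<alpha> x :: real
  assumes "\<alpha> > -1" "x \<ge> 0"
  shows "bessel_I \<alpha> x = (x / 2) powr \<alpha> * bessel_series \<alpha> ((x / 2)\<^sup>2)"
proof (cases "x = 0")
  case True
  thus ?thesis by (simp add: bessel_I_def)
next
  case False
  have pow: "(x / 2) powr (2 * real k + \<alpha>) = (x / 2) powr \<alpha> * ((x / 2)\<^sup>2) ^ k" for k :: nat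
    using powr_realpow[of "x / 2" "2 * k"] False assms
    by (simp add: powr_add power_mult[symmetric])
  show ?thesis
    unfolding bessel_I_def bessel_series_def pow
    by (subst suminf_mult[symmetric, OF summable_bessel_series]) (use assms in simp_all)
qed

lemma bessel_I_nonneg:
  fixes \<alpha> x :: real
  assumes "\<alpha> > -1" "x \<ge> 0"
  shows "bessel_I \<alpha> x \<ge> 0"
  by (simp add: bessel_I_eq_powr_mult_series bessel_series_nonneg assms)

text \<open>The powers of \<open>t\<close> combine to \<open>t\<^sup>q\<^sup>-\<^sup>\<mu> t\<^sup>\<mu> = t\<^sup>q\<close>, whose singularity at the origin is
  integrable; the remaining factors are continuous on the compact interval.\<close>

lemma bessel_integrand_integrable:
  fixes \<mu> q \<gamma> x :: real
  assumes "\<mu> > -1" "q > -1" "x \<ge> 0"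
  shows "(\<lambda>t. exp (- \<gamma> * t) * t powr (q - \<mu>) * bessel_I \<mu> t) integrable_on {0..x}"
proof -
  define g where "g t = exp (- \<gamma> * t) * (1 / 2) powr \<mu> * bessel_series \<mu> ((t / 2)\<^sup>2)" for t
  have cont: "continuous_on {0..x} g"
    unfolding g_def
    by (intro continuous_intros continuous_on_compose2[OF continuous_bessel_series[of _ UNIV]] assms)
      auto
  have "(\<lambda>t. t powr q) absolutely_integrable_on {0..x}"
    using assms by (intro nonnegative_absolutely_integrable_1 integrable_on_powr_from_0) auto
  moreover have "bounded (g ` {0..x})"
    by (intro compact_imp_bounded compact_continuous_image cont) auto
  moreover have "g \<in> borel_measurable (lebesgue_on {0..x})"
    by (intro continuous_imp_measurable_on_sets_lebesgue cont) auto
  ultimately have "(\<lambda>t. g t * t powr q) absolutely_integrable_on {0..x}"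
    by (intro absolutely_integrable_bounded_measurable_product_real) auto
  hence "(\<lambda>t. g t * t powr q) integrable_on {0..x}"
    by (rule absolutely_integrable_on_def[THEN iffD1, THEN conjunct1])
  moreover have "g t * t powr q = exp (- \<gamma> * t) * t powr (q - \<mu>) * bessel_I \<mu> t"
    if "t \<in> {0..x}" for t
  proof -
    have "t powr q = t powr (q - \<mu>) * t powr \<mu>" by (simp flip: powr_add)
    moreover have "(t / 2) powr \<mu> = (1 / 2) powr \<mu> * t powr \<mu>"
      using that powr_mult[of "1 / 2" t \<mu>] by simp
    ultimately show ?thesis
      using that assms by (simp add: g_def bessel_I_eq_powr_mult_series)
  qed
  ultimately show ?thesis by (rule integrable_eq)
qed

lemma normalised_kernel_eq:
  fixes \<mu> q \<gamma> x t :: real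
  assumes "x > 0" "t \<ge> 0"
  shows "exp (\<gamma> * (x - t)) * (t / x) powr (q - \<mu>) * bessel_I \<mu> t
    = 1 / (exp (- \<gamma> * x) * x powr (q - \<mu>)) * (exp (- \<gamma> * t) * t powr (q - \<mu>) * bessel_I \<mu> t)"
proof -
  have "exp (\<gamma> * (x - t)) = exp (- \<gamma> * t) / exp (- \<gamma> * x)"
    by (simp add: exp_diff[symmetric] algebra_simps)
  thus ?thesis using assms by (simp add: powr_divide)
qed

lemma normalised_kernel_integrable:
  fixes \<mu> q \<gamma> x :: real
  assumes "\<mu> > -1" "q > -1" "x > 0"
  shows "(\<lambda>t. exp (\<gamma> * (x - t)) * (t / x) powr (q - \<mu>) * bessel_I \<mu> t) integrable_on {0..x}"
proof (rule integrable_eq)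
  show "(\<lambda>t. 1 / (exp (- \<gamma> * x) * x powr (q - \<mu>))
      * (exp (- \<gamma> * t) * t powr (q - \<mu>) * bessel_I \<mu> t)) integrable_on {0..x}"
    using assms by (intro integrable_on_mult_right bessel_integrand_integrable) auto
qed (use assms in \<open>subst normalised_kernel_eq, auto\<close>)

lemma bessel_ratio_eq_normalised:
  fixes \<mu> q \<gamma> x :: real
  assumes "x > 0"
  shows "bessel_ratio \<mu> q \<gamma> x
    = integral {0..x} (\<lambda>t. exp (\<gamma> * (x - t)) * (t / x) powr (q - \<mu>) * bessel_I \<mu> t)
        / bessel_I (\<mu> + 1) x"
proof -
  have "integral {0..x} (\<lambda>t. exp (\<gamma> * (x - t)) * (t / x) powr (q - \<mu>) * bessel_I \<mu> t)
    = integral {0..x} (\<lambda>t. 1 / (exp (- \<gamma> * x) * x powr (q - \<mu>))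
        * (exp (- \<gamma> * t) * t powr (q - \<mu>) * bessel_I \<mu> t))"
    using assms by (intro integral_cong normalised_kernel_eq) auto
  also have "\<dots> = 1 / (exp (- \<gamma> * x) * x powr (q - \<mu>))
      * integral {0..x} (\<lambda>t. exp (- \<gamma> * t) * t powr (q - \<mu>) * bessel_I \<mu> t)"
    by (rule integral_mult_right)
  finally show ?thesis by (simp add: bessel_ratio_def)
qed

text \<open>Both monotonicity claims are instances of this joint statement, obtained by fixing one of
  the two parameters.\<close>

lemma bessel_ratio_mono:
  fixes \<mu> q q' \<gamma> \<gamma>' x :: real
  assumes "\<mu> > -1" "-1 < q'" "q' \<le> q" "\<gamma> \<le> \<gamma>'" "x > 0"
  shows "bessel_ratio \<mu> q \<gamma> x \<le> bessel_ratio \<mu> q' \<gamma>' x"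
proof -
  have "exp (\<gamma> * (x - t)) * (t / x) powr (q - \<mu>) * bessel_I \<mu> t
      \<le> exp (\<gamma>' * (x - t)) * (t / x) powr (q' - \<mu>) * bessel_I \<mu> t"
    if t: "t \<in> {0..x}" for t
  proof (intro mult_right_mono mult_mono)
    show "exp (\<gamma> * (x - t)) \<le> exp (\<gamma>' * (x - t))"
      using t assms by (simp add: mult_right_mono)
    show "(t / x) powr (q - \<mu>) \<le> (t / x) powr (q' - \<mu>)"
      using t assms by (intro powr_mono') auto
  qed (use t assms in \<open>auto intro: bessel_I_nonneg\<close>)
  hence "integral {0..x} (\<lambda>t. exp (\<gamma> * (x - t)) * (t / x) powr (q - \<mu>) * bessel_I \<mu> t)
      \<le> integral {0..x} (\<lambda>t. exp (\<gamma>' * (x - t)) * (t / x) powr (q' - \<mu>) * bessel_I \<mu> t)"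
    using assms by (intro integral_le normalised_kernel_integrable) auto
  thus ?thesis
    using assms bessel_I_nonneg[of "\<mu> + 1" x]
    by (simp add: bessel_ratio_eq_normalised divide_right_mono)
qed

lemma sharp_const_mono:
  fixes \<mu> q q' \<gamma> \<gamma>' :: real
  assumes "\<mu> > -1" "-1 < q'" "q' \<le> q" "\<gamma> \<le> \<gamma>'"
  shows "sharp_const \<mu> q \<gamma> \<le> sharp_const \<mu> q' \<gamma>'"
  unfolding sharp_const_def
proof (rule SUP_mono)
  fix x :: real
  assume "x \<in> {0<..}"
  thus "\<exists>y\<in>{0<..}. ereal (bessel_ratio \<mu> q \<gamma> x) \<le> ereal (bessel_ratio \<mu> q' \<gamma>' y)"
    using assms by (intro bexI[of _ x]) (auto intro: bessel_ratio_mono)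
qed

theorem theorem7p2:
  fixes \<mu> :: real
  assumes "\<mu> > -1"
  shows "(\<forall>\<gamma>\<in>{0<..<1}. antimono_on {-1<..} (\<lambda>q. sharp_const \<mu> q \<gamma>)) \<and>
         (\<forall>q\<in>{-1<..}. mono_on {0<..<1} (\<lambda>\<gamma>. sharp_const \<mu> q \<gamma>))"
  using assms by (auto simp: monotone_on_def intro!: sharp_const_mono)

end
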